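(* Let $G=(V,E)$ be a finite simple connected graph of diameter $d$, and for each $i$ let $S_i=\{u\in V : ecc(u)=i\}$ be the set of vertices of $G$ of eccentricity $i$. Then the eccentric graph $ecc(G)$ is isomorphic to the complement $\overline{G}$ of $G$ if and only if both of the following hold: (i) $S_i=\emptyset$ for $i=1$ and for all $i\ge 4$; (ii) $d_G(u,v)\neq 2$ for all $u,v\in S_3$.
   Context: For a connected graph $G=(V,E)$, $d_G(u,v)$ is the minimum number of edges of a path from $u$ to $v$. The eccentricity of a vertex $u$ is $ecc(u)=\max_{v\in V} d_G(u,v)$, and the diameter of $G$ is the maximum eccentricity of its vertices. The eccentric graph $ecc(G)$ is the simple graph with vertex set $V$ in which two distinct vertices $u,v$ are adjacent if and only if $d_G(u,v)=ecc(u)$ or $d_G(u,v)=ecc(v)$ (distances and eccentricities taken in $G$). *)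

theory Defs
  imports "Graph_Theory.Graph_Theory"
begin

text \<open>A finite simple graph is a \<^locale>\<open>pair_graph\<close>: finite vertex set, symmetric and irreflexive
  set of arcs, the edge \<open>uv\<close> being the two arcs \<open>(u, v)\<close> and \<open>(v, u)\<close>. Hence the length of an
  arc path is its number of edges, and \<^const>\<open>digraph_iso\<close> between two such graphs is the
  usual graph isomorphism.\<close>

text \<open>Unspecified if no path from \<open>u\<close> to \<open>v\<close> exists; only used for connected graphs.\<close>
definition graph_dist :: "'a pair_pre_digraph \<Rightarrow> 'a \<Rightarrow> 'a \<Rightarrow> nat" where
  "graph_dist G u v = (LEAST n. \<exists>p. pre_digraph.apath (with_proj G) u p v \<and> length p = n)"

definition eccentricity :: "'a pair_pre_digraph \<Rightarrow> 'a \<Rightarrow> nat" where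
  "eccentricity G u = Max ((\<lambda>v. graph_dist G u v) ` pverts G)"

definition graph_diameter :: "'a pair_pre_digraph \<Rightarrow> nat" where
  "graph_diameter G = Max (eccentricity G ` pverts G)"

definition ecc_level :: "'a pair_pre_digraph \<Rightarrow> nat \<Rightarrow> 'a set" where
  "ecc_level G i = {u \<in> pverts G. eccentricity G u = i}"

definition eccentric_graph :: "'a pair_pre_digraph \<Rightarrow> 'a pair_pre_digraph" where
  "eccentric_graph G = \<lparr> pverts = pverts G,
     parcs = {(u, v). u \<in> pverts G \<and> v \<in> pverts G \<and> u \<noteq> v \<and>
       (graph_dist G u v = eccentricity G u \<or> graph_dist G u v = eccentricity G v)} \<rparr>"

definition complement_graph :: "'a pair_pre_digraph \<Rightarrow> 'a pair_pre_digraph" where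
  "complement_graph G = \<lparr> pverts = pverts G,
     parcs = {(u, v). u \<in> pverts G \<and> v \<in> pverts G \<and> u \<noteq> v \<and> (u, v) \<notin> parcs G} \<rparr>"

end

theory Submission
  imports Defs
begin

text \<open>
  The graph \<open>ecc(G)\<close> and the complement of \<open>G\<close> can be isomorphic only by being equal
  (lemma \<open>iso_iff_eq_complement\<close>).

  A vertex of eccentricity 1 is adjacent to all other vertices in \<open>G\<close>, hence isolated in the
  complement; but in \<open>ecc(G)\<close> it is adjacent to all other vertices as well, so \<open>ecc(G)\<close> has no
  isolated vertex and the graphs are not isomorphic. Without vertices of eccentricity 1, an edge of
  \<open>ecc(G)\<close> joins vertices at distance at least 2, so \<open>ecc(G)\<close> is a spanning subgraph of the
  complement. Isomorphic finite graphs have equally many edges, which leaves only equality.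

  Equality is a statement on distances (lemma \<open>eq_complement_iff\<close>). It holds if and only if no
  vertex has eccentricity 1 and no pair of distinct non-adjacent vertices is at a distance smaller
  than both of its eccentricities. If all eccentricities are at most 3, such a pair can only consist
  of vertices of eccentricity 3 at distance 2. If some eccentricity is \<open>k \<ge> 4\<close>, such a pair always
  exists: on a geodesic \<open>x\<^sub>0, \<dots>, x\<^sub>k\<close> take \<open>x\<^sub>1\<close> and \<open>x\<^sub>3\<close>, at distance 2, whose eccentricities are
  at least \<open>d(x\<^sub>1, x\<^sub>k) = k - 1 \<ge> 3\<close> and \<open>d(x\<^sub>0, x\<^sub>3) = 3\<close> (lemma \<open>ecc_ge_4_imp_close_pair\<close>).
\<close>

section \<open>The distance of a connected graph as a metric\<close>

locale connected_pair_graph = pair_graph G for G :: "'a pair_pre_digraph" +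
  assumes connected: "connected (with_proj G)"
begin

abbreviation "d \<equiv> graph_dist G"
abbreviation "ecc \<equiv> eccentricity G"

text \<open>The distance is defined by paths; cutting closed detours out of a walk shows that walks may
  be used instead, and these can be concatenated and reversed.\<close>

lemma shorter_apath:
  assumes "awalk u p v"
  shows "\<exists>q. apath u q v \<and> length q \<le> length p"
  using assms
proof (induction "length p" arbitrary: p rule: less_induct)
  case less
  show ?case
  proof (cases "distinct (awalk_verts u p)")
    case True
    with less.prems show ?thesis by (auto simp: apath_def)
  next
    case False
    then obtain q r s w where "p = q @ r @ s" "0 < length r" "awalk u q w" "awalk w s v"
      using awalk_not_distinct_decomp[OF less.prems] by auto
    then have "awalk u (q @ s) v" "length (q @ s) < length p"
      by (auto intro: awalk_appendI simp del: awalk_append_iff)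
    then show ?thesis
      using less.hyps[of "q @ s"] by fastforce
  qed
qed

lemma dist_le_length: "d u v \<le> length p" if walk: "awalk u p v"
proof -
  obtain q where "apath u q v" "length q \<le> length p"
    using shorter_apath[OF walk] by blast
  then have "d u v \<le> length q"
    unfolding graph_dist_def by (intro Least_le) blast
  with \<open>length q \<le> length p\<close> show ?thesis by simp
qed

lemma geodesic:
  assumes "u \<in> pverts G" "v \<in> pverts G"
  obtains p where "awalk u p v" "length p = d u v"
proof -
  have "strongly_connected (with_proj G)"
    using connected sym_arcs by (rule symmetric_connected_imp_strongly_connected[rotated])
  then have "u \<rightarrow>\<^sup>*\<^bsub>with_proj G\<^esub> v"
    using assms by (auto simp: strongly_connected_def)
  then obtain p where "apath u p v"
    by (auto simp: reachable_apath)
  then have "\<exists>n p. apath u p v \<and> length p = n" by blast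
  then have "\<exists>p. apath u p v \<and> length p = d u v"
    unfolding graph_dist_def by (rule LeastI_ex)
  then show thesis using that by (auto intro: awalkI_apath)
qed

lemma dist_triangle:
  assumes "u \<in> pverts G" "v \<in> pverts G" "w \<in> pverts G"
  shows "d u w \<le> d u v + d v w"
proof -
  obtain p q where p: "awalk u p v" "length p = d u v" and q: "awalk v q w" "length q = d v w"
    using assms geodesic by metis
  then show ?thesis
    using dist_le_length[OF awalk_appendI[OF p(1) q(1)]] by simp
qed

lemma dist_eq_0_iff: "d u v = 0 \<longleftrightarrow> u = v" if "u \<in> pverts G" "v \<in> pverts G"
proof
  assume "d u v = 0"
  then show "u = v"
    using geodesic[OF that] awalk_empty_ends by (metis length_0_conv)
next
  assume "u = v"
  then have "awalk u [] v" using that by (simp add: awalk_Nil_iff)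
  then show "d u v = 0" using dist_le_length[of u "[]" v] by simp
qed

lemma dist_eq_1_iff: "d u v = 1 \<longleftrightarrow> (u, v) \<in> parcs G" if uv: "u \<in> pverts G" "v \<in> pverts G"
proof
  assume "d u v = 1"
  then obtain p where "awalk u p v" "length p = 1"
    using geodesic[OF uv] by metis
  then obtain e where "awalk u [e] v"
    by (auto simp: length_Suc_conv)
  then show "(u, v) \<in> parcs G"
    by (cases e) (auto simp: awalk_simps)
next
  assume arc: "(u, v) \<in> parcs G"
  then have "awalk u [(u, v)] v" using uv by (simp add: awalk_simps)
  then have "d u v \<le> 1" using dist_le_length[of u "[(u, v)]" v] by simp
  moreover have "u \<noteq> v" using no_loops[OF arc] by simp
  then have "d u v \<noteq> 0" using dist_eq_0_iff[OF uv] by simp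
  ultimately show "d u v = 1" by simp
qed

lemma dist_ge_2_iff:
  "2 \<le> d u v \<longleftrightarrow> u \<noteq> v \<and> (u, v) \<notin> parcs G" if "u \<in> pverts G" "v \<in> pverts G"
  using dist_eq_0_iff[OF that] dist_eq_1_iff[OF that] by linarith

lemma reverse_awalk: "\<exists>q. awalk v q u \<and> length q = length p" if "awalk u p v"
  using that
proof (induction p arbitrary: u)
  case Nil
  then show ?case by (auto simp: awalk_Nil_iff)
next
  case (Cons e p)
  then have e: "e \<in> parcs G" "fst e = u" and "awalk (snd e) p v"
    by (auto simp: awalk_Cons_iff)
  then obtain q where q: "awalk v q (snd e)" "length q = length p"
    using Cons.IH by blast
  have "(snd e, u) \<in> parcs G"
    using e arcs_symmetric by (metis prod.collapse)
  then have "awalk (snd e) [(snd e, u)] u"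
    by (auto simp: awalk_simps dest: arc_snd_in_verts)
  then have "awalk v (q @ [(snd e, u)]) u"
    by (rule awalk_appendI[OF q(1)])
  then show ?case using q(2) by (metis length_append_singleton length_Cons)
qed

lemma dist_commute: "d u v = d v u" if "u \<in> pverts G" "v \<in> pverts G"
proof -
  have "d y x \<le> d x y" if "x \<in> pverts G" "y \<in> pverts G" for x y
    using geodesic[OF that] reverse_awalk dist_le_length by metis
  then show ?thesis using that by (intro antisym)
qed

text \<open>Every prefix and every suffix of a geodesic is a geodesic.\<close>

lemma vertex_on_geodesic:
  assumes "u \<in> pverts G" "v \<in> pverts G" "j \<le> d u v"
  obtains x where "x \<in> pverts G" "d u x = j" "d x v = d u v - j"
proof -
  obtain p where p: "awalk u p v" "length p = d u v"
    using geodesic assms by blast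
  define x where "x = awlast u (take j p)"
  have walks: "awalk u (take j p) x" "awalk x (drop j p) v"
    using p(1) awalk_append_iff[of u "take j p" "drop j p" v] by (simp_all add: x_def)
  have x: "x \<in> pverts G" using walks(2) by (rule awalk_hd_in_verts)
  have "d u x \<le> j" "d x v \<le> d u v - j"
    using dist_le_length[OF walks(1)] dist_le_length[OF walks(2)] p(2) assms(3) by auto
  moreover have "d u v \<le> d u x + d x v"
    using dist_triangle assms x by simp
  ultimately have "d u x = j" "d x v = d u v - j" using assms(3) by auto
  then show thesis by (rule that[OF x])
qed

lemma dist_le_ecc: "d u v \<le> ecc u" if "v \<in> pverts G"
  unfolding eccentricity_def using that by (intro Max_ge) auto

lemma ecc_attained:
  assumes "u \<in> pverts G"
  obtains v where "v \<in> pverts G" "d u v = ecc u"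
proof -
  have "ecc u \<in> d u ` pverts G"
    unfolding eccentricity_def using assms by (intro Max_in) auto
  then show thesis using that by auto
qed

lemma dist_le_eccs: "d u v \<le> ecc u" "d u v \<le> ecc v" if "u \<in> pverts G" "v \<in> pverts G"
  using that dist_le_ecc dist_commute by metis+

section \<open>Equality of the eccentric graph and the complement\<close>

lemma eccentric_arc_iff:
  "(u, v) \<in> parcs (eccentric_graph G) \<longleftrightarrow>
    u \<in> pverts G \<and> v \<in> pverts G \<and> u \<noteq> v \<and> (d u v = ecc u \<or> d u v = ecc v)"
  by (simp add: eccentric_graph_def)

lemma complement_arc_iff:
  "(u, v) \<in> parcs (complement_graph G) \<longleftrightarrow> u \<in> pverts G \<and> v \<in> pverts G \<and> 2 \<le> d u v"
  using dist_ge_2_iff by (auto simp: complement_graph_def)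

lemma eq_complement_iff_arcs:
  "eccentric_graph G = complement_graph G \<longleftrightarrow>
    (\<forall>u\<in>pverts G. \<forall>v\<in>pverts G. u \<noteq> v \<and> (d u v = ecc u \<or> d u v = ecc v) \<longleftrightarrow> 2 \<le> d u v)"
proof -
  have "eccentric_graph G = complement_graph G \<longleftrightarrow>
      parcs (eccentric_graph G) = parcs (complement_graph G)"
    by (simp add: eccentric_graph_def complement_graph_def)
  also have "\<dots> \<longleftrightarrow> (\<forall>u v. (u, v) \<in> parcs (eccentric_graph G) \<longleftrightarrow> (u, v) \<in> parcs (complement_graph G))"
    by auto
  finally show ?thesis
    unfolding eccentric_arc_iff complement_arc_iff by blast
qed

lemma no_ecc_1_imp_dist_ge_2:
  assumes "ecc_level G 1 = {}" "(u, v) \<in> parcs (eccentric_graph G)"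
  shows "2 \<le> d u v"
proof -
  have uv: "u \<in> pverts G" "v \<in> pverts G" "u \<noteq> v" "d u v = ecc u \<or> d u v = ecc v"
    using assms(2) by (auto simp: eccentric_arc_iff)
  moreover have "ecc u \<noteq> 1" "ecc v \<noteq> 1"
    using uv assms(1) by (auto simp: ecc_level_def)
  ultimately have "d u v \<noteq> 1" "d u v \<noteq> 0" using dist_eq_0_iff by auto
  then show ?thesis by simp
qed

text \<open>The pair consists of the points number 1 and 3 on a geodesic from \<open>u\<close> to a vertex farthest
  from \<open>u\<close>: one of them is far from the end of the geodesic, the other one from its start.\<close>

lemma ecc_ge_4_imp_close_pair:
  assumes "u \<in> pverts G" "4 \<le> ecc u"
  obtains x y where "x \<in> pverts G" "y \<in> pverts G" "d x y = 2" "3 \<le> ecc x" "3 \<le> ecc y"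
proof -
  obtain v where v: "v \<in> pverts G" "d u v = ecc u"
    using ecc_attained assms(1) by blast
  obtain x where x: "x \<in> pverts G" "d x v = ecc u - 1"
    using vertex_on_geodesic[OF assms(1) v(1), of 1] v(2) assms(2) by auto
  obtain y where y: "y \<in> pverts G" "d x y = 2" "d y v = ecc u - 3"
  proof (rule vertex_on_geodesic[OF x(1) v(1), of 2])
    show "2 \<le> d x v" using x(2) assms(2) by simp
  qed (use x(2) in simp)
  have "3 \<le> ecc x"
    using dist_le_ecc[OF v(1), of x] x(2) assms(2) by simp
  moreover have "3 \<le> d u y"
    using dist_triangle[OF assms(1) y(1) v(1)] v(2) y(3) assms(2) by simp
  then have "3 \<le> ecc y"
    using dist_le_eccs(2)[OF assms(1) y(1)] by simp
  ultimately show thesis using that x(1) y(1,2) by blast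
qed

lemma eq_complement_iff:
  "eccentric_graph G = complement_graph G \<longleftrightarrow>
    (\<forall>i. i = 1 \<or> i \<ge> 4 \<longrightarrow> ecc_level G i = {}) \<and>
    (\<forall>u \<in> ecc_level G 3. \<forall>v \<in> ecc_level G 3. d u v \<noteq> 2)"
    (is "?eq \<longleftrightarrow> ?levels \<and> ?no_close_pair")
proof
  assume ?eq
  then have arcs: "(u \<noteq> v \<and> (d u v = ecc u \<or> d u v = ecc v)) \<longleftrightarrow> 2 \<le> d u v"
    if "u \<in> pverts G" "v \<in> pverts G" for u v
    using that unfolding eq_complement_iff_arcs by blast
  have "ecc u \<noteq> 1" if u: "u \<in> pverts G" for u
  proof
    assume "ecc u = 1"
    then obtain v where v: "v \<in> pverts G" "d u v = ecc u" "d u v = 1"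
      using ecc_attained[OF u] by metis
    then show False using arcs[OF u v(1)] dist_eq_0_iff[OF u v(1)] by simp
  qed
  moreover have "\<not> 4 \<le> ecc u" if u: "u \<in> pverts G" for u
  proof
    assume "4 \<le> ecc u"
    with u obtain x y where "x \<in> pverts G" "y \<in> pverts G" "d x y = 2" "3 \<le> ecc x" "3 \<le> ecc y"
      by (rule ecc_ge_4_imp_close_pair)
    then show False using arcs[of x y] by simp
  qed
  ultimately have ?levels by (auto simp: ecc_level_def)
  moreover have "d u v \<noteq> 2" if "u \<in> ecc_level G 3" "v \<in> ecc_level G 3" for u v
    using arcs[of u v] that by (auto simp: ecc_level_def)
  ultimately show "?levels \<and> ?no_close_pair" by blast
next
  assume R: "?levels \<and> ?no_close_pair"
  have small: "ecc u < 4" if "u \<in> pverts G" for u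
  proof (rule ccontr)
    assume "\<not> ecc u < 4"
    then have "ecc_level G (ecc u) = {}" using R by simp
    moreover have "u \<in> ecc_level G (ecc u)" using that by (simp add: ecc_level_def)
    ultimately show False by blast
  qed
  have "u \<noteq> v \<and> (d u v = ecc u \<or> d u v = ecc v)"
    if uv: "u \<in> pverts G" "v \<in> pverts G" and far: "2 \<le> d u v" for u v
  proof -
    have "u \<noteq> v" using far dist_ge_2_iff uv by blast
    moreover have "d u v = ecc u \<or> d u v = ecc v"
    proof (rule ccontr)
      assume "\<not> ?thesis"
      then have "d u v < ecc u" "d u v < ecc v"
        using dist_le_eccs[OF uv] by auto
      then have "ecc u = 3" "ecc v = 3" "d u v = 2"
        using far small[OF uv(1)] small[OF uv(2)] by linarith+
      then show False using R uv by (auto simp: ecc_level_def)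
    qed
    ultimately show ?thesis ..
  qed
  moreover have "ecc_level G 1 = {}" using R by blast
  then have "2 \<le> d u v"
    if "u \<in> pverts G" "v \<in> pverts G" "u \<noteq> v \<and> (d u v = ecc u \<or> d u v = ecc v)" for u v
    using that no_ecc_1_imp_dist_ge_2 eccentric_arc_iff by blast
  ultimately show ?eq unfolding eq_complement_iff_arcs by blast
qed

end

section \<open>Isomorphism forces equality\<close>

lemma digraph_iso_no_isolated:
  assumes "digraph_iso G H"
    and "\<And>x. x \<in> verts G \<Longrightarrow> \<exists>a\<in>arcs G. tail G a = x"
    and "y \<in> verts H"
  shows "\<exists>a\<in>arcs H. tail H a = y"
proof -
  obtain f where f: "pre_digraph.digraph_isomorphism G f" and H: "H = app_iso f G"
    using assms(1) by (auto simp: digraph_iso_def)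
  obtain x where x: "x \<in> verts G" "y = iso_verts f x"
    using assms(3) H by auto
  then obtain a where a: "a \<in> arcs G" "tail G a = x" using assms(2) by blast
  then have "tail H (iso_arcs f a) = y"
    using x H pre_digraph.iso_verts_tail[OF f a(1)] by simp
  then show ?thesis using a H by auto
qed

lemma digraph_iso_card_arcs:
  assumes "digraph_iso G H"
  shows "card (arcs G) = card (arcs H)"
  using assms
  by (auto simp: digraph_iso_def card_image pre_digraph.digraph_isomorphism_inj_on_arcs)

lemma digraph_iso_refl:
  assumes "wf_digraph G"
  shows "digraph_iso G G"
proof -
  define f where "f = \<lparr>iso_verts = id, iso_arcs = id, iso_head = head G, iso_tail = tail G\<rparr>"
  have "pre_digraph.digraph_isomorphism G f"
    using assms by (simp add: f_def pre_digraph.digraph_isomorphism_def)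
  moreover have "G = app_iso f G"
    by (simp add: f_def app_iso_def)
  ultimately show ?thesis unfolding digraph_iso_def by blast
qed

context connected_pair_graph
begin

text \<open>A vertex of eccentricity 1 is joined to all others in \<open>G\<close> and in the eccentric graph alike:
  it is isolated in the complement, but prevents isolated vertices in the eccentric graph.\<close>

lemma iso_imp_no_ecc_1:
  assumes iso: "digraph_iso (with_proj (eccentric_graph G)) (with_proj (complement_graph G))"
  shows "ecc_level G 1 = {}"
proof (rule ccontr)
  assume "ecc_level G 1 \<noteq> {}"
  then obtain w where w: "w \<in> pverts G" "ecc w = 1"
    by (auto simp: ecc_level_def)
  have near: "d w v \<le> 1" if "v \<in> pverts G" for v
    using dist_le_ecc[OF that, of w] w(2) by simp
  obtain v where v: "v \<in> pverts G" "d w v = 1"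
    using ecc_attained w by metis
  have "\<exists>y. (x, y) \<in> parcs (eccentric_graph G)" if x: "x \<in> pverts G" for x
  proof (cases "x = w")
    case True
    have "w \<noteq> v" using v w(1) dist_eq_0_iff by fastforce
    then show ?thesis using True v w by (auto simp: eccentric_arc_iff)
  next
    case False
    then have "d x w = 1"
      using near[OF x] dist_commute[OF x w(1)] dist_eq_0_iff[OF x w(1)] by simp
    then show ?thesis using False w x by (auto simp: eccentric_arc_iff)
  qed
  then have "\<exists>a\<in>parcs (eccentric_graph G). fst a = x" if "x \<in> pverts G" for x
    using that by force
  then have "\<exists>a\<in>parcs (complement_graph G). fst a = w"
    using digraph_iso_no_isolated[OF iso, of w] w(1)
    by (simp add: eccentric_graph_def complement_graph_def)
  then obtain y where "(w, y) \<in> parcs (complement_graph G)" by force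
  then show False using near by (fastforce simp: complement_arc_iff)
qed

text \<open>Without eccentricity 1 the eccentric graph is contained in the complement, and containment
  with equally many arcs is equality.\<close>

lemma iso_iff_eq_complement:
  "digraph_iso (with_proj (eccentric_graph G)) (with_proj (complement_graph G)) \<longleftrightarrow>
    eccentric_graph G = complement_graph G"
proof
  assume iso: "digraph_iso (with_proj (eccentric_graph G)) (with_proj (complement_graph G))"
  have "parcs (eccentric_graph G) \<subseteq> parcs (complement_graph G)"
    using no_ecc_1_imp_dist_ge_2[OF iso_imp_no_ecc_1[OF iso]]
    by (auto simp: complement_arc_iff eccentric_arc_iff)
  moreover have "parcs (complement_graph G) \<subseteq> pverts G \<times> pverts G"
    by (auto simp: complement_graph_def)
  then have "finite (parcs (complement_graph G))"
    by (rule finite_subset) simp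
  moreover have "card (parcs (eccentric_graph G)) = card (parcs (complement_graph G))"
    using digraph_iso_card_arcs[OF iso] by simp
  ultimately have "parcs (eccentric_graph G) = parcs (complement_graph G)"
    by (intro card_subset_eq)
  then show "eccentric_graph G = complement_graph G"
    by (simp add: eccentric_graph_def complement_graph_def)
next
  assume "eccentric_graph G = complement_graph G"
  moreover have "wf_digraph (with_proj (complement_graph G))"
    by (auto simp: wf_digraph_def complement_graph_def)
  ultimately show "digraph_iso (with_proj (eccentric_graph G)) (with_proj (complement_graph G))"
    by (simp add: digraph_iso_refl)
qed

end

theorem theorem2p3:
  fixes G :: "'a pair_pre_digraph" and d :: nat
  assumes "pair_graph G"
    and "connected (with_proj G)"
    and "graph_diameter G = d"
  shows "digraph_iso (with_proj (eccentric_graph G)) (with_proj (complement_graph G)) \<longleftrightarrow>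
    (\<forall>i. i = 1 \<or> i \<ge> 4 \<longrightarrow> ecc_level G i = {}) \<and>
    (\<forall>u \<in> ecc_level G 3. \<forall>v \<in> ecc_level G 3. graph_dist G u v \<noteq> 2)"
proof -
  interpret connected_pair_graph G
    using assms(1,2) by (intro connected_pair_graph.intro connected_pair_graph_axioms.intro)
  show ?thesis
    unfolding iso_iff_eq_complement by (rule eq_complement_iff)
qed

end
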